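(* For all positive integers $n$ and $k$, $$c_1\left(K_{2,n}^{\oslash k}\right) \;\leq\; 2 - \frac{2}{2\lceil n/2 \rceil + 1}.$$
   Context: An $s$-$t$ graph is a graph $G$ with two distinguished vertices $s(G), t(G)$. Graphs carry edge lengths $\mathrm{len}$ and are viewed as metric spaces with the shortest-path metric. For $s$-$t$ graphs $H,G$ with edge lengths, $H \oslash G$ is the $s$-$t$ graph obtained by replacing each edge $e=(u,v)$ of $H$ by a new copy of $G$, with $s(G)$ identified with $u$ and $t(G)$ identified with $v$ (with respect to an arbitrary fixed orientation of the edges of $H$; for $G=K_{2,n}$ the orientation is irrelevant by symmetry). The edges of the copy of $G$ replacing $e$ have their $G$-lengths multiplied by $\mathrm{len}_H(e)/d_G(s(G),t(G))$, and $s(H\oslash G)=s(H)$, $t(H \oslash G)=t(H)$. $G^{\oslash 0}$ is a single edge of unit length (its endpoints being $s$ and $t$), and $G^{\oslash k} = G^{\oslash (k-1)} \oslash G$ for $k \ge 1$. $K_{2,n}$ is the complete bipartite graph with $2$ vertices on one side and $n$ on the other, with unit edge lengths; it is an $s$-$t$ graph whose vertices $s,t$ are the two vertices of the side of size 2. For a map $f:(X,d_X)\to(Y,d_Y)$ between metric spaces, $\|f\|_{\mathrm{Lip}} = \sup_{x\ne y} d_Y(f(x),f(y))/d_X(x,y)$, and for injective $f$ the distortion is $\mathrm{dist}(f)=\|f\|_{\mathrm{Lip}}\cdot\|f^{-1}\|_{\mathrm{Lip}}$ (and $\infty$ if $f$ is not injective). For a metric space $X$, $c_1(X)$ is the least distortion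 (infimum of $\mathrm{dist}(f)$) over maps $f: X\to L_1$. Here $c_1(K_{2,n}^{\oslash k})$ refers to the shortest-path metric on $V(K_{2,n}^{\oslash k})$ in which every edge of $K_{2,n}^{\oslash k}$ has length $2^{-k}$ (these are the lengths produced by the recursive definition of $K_{2,n}^{\oslash k}$, since $d_{K_{2,n}}(s,t)=2$). *)

theory Defs
  imports "HOL-Analysis.Analysis"
begin

abbreviation unit_leb :: "real measure" where
  "unit_leb \<equiv> lebesgue_on {0..1}"

definition L1_rel :: "(real \<Rightarrow> real) \<Rightarrow> (real \<Rightarrow> real) \<Rightarrow> bool" where
  "L1_rel f g \<longleftrightarrow> integrable unit_leb f \<and> integrable unit_leb g \<and> (AE x in unit_leb. f x = g x)"

quotient_type L1 = "real \<Rightarrow> real" / partial: L1_rel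
proof (rule part_equivpI)
  show "\<exists>f. L1_rel f f"
    by (rule exI[of _ "\<lambda>_. 0"]) (simp add: L1_rel_def)
  show "symp L1_rel"
    by (rule sympI) (auto simp: L1_rel_def elim: eventually_mono)
  show "transp L1_rel"
  proof (rule transpI)
    fix f g h assume "L1_rel f g" "L1_rel g h"
    then show "L1_rel f h"
      unfolding L1_rel_def by (auto elim: eventually_elim2)
  qed
qed

instantiation L1 :: metric_space
begin

lift_definition dist_L1 :: "L1 \<Rightarrow> L1 \<Rightarrow> real" is
  "\<lambda>f g. \<integral>x. \<bar>f x - g x\<bar> \<partial>unit_leb"
proof -
  fix f f' g g' assume "L1_rel f f'" "L1_rel g g'"
  then have int: "integrable unit_leb f" "integrable unit_leb f'"
      "integrable unit_leb g" "integrable unit_leb g'"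
    and ae: "AE x in unit_leb. f x = f' x" "AE x in unit_leb. g x = g' x"
    by (auto simp: L1_rel_def)
  show "(\<integral>x. \<bar>f x - g x\<bar> \<partial>unit_leb) = (\<integral>x. \<bar>f' x - g' x\<bar> \<partial>unit_leb)"
  proof (rule integral_cong_AE)
    show "(\<lambda>x. \<bar>f x - g x\<bar>) \<in> borel_measurable unit_leb"
      using int by (intro borel_measurable_integrable integrable_abs Bochner_Integration.integrable_diff)
    show "(\<lambda>x. \<bar>f' x - g' x\<bar>) \<in> borel_measurable unit_leb"
      using int by (intro borel_measurable_integrable integrable_abs Bochner_Integration.integrable_diff)
    show "AE x in unit_leb. \<bar>f x - g x\<bar> = \<bar>f' x - g' x\<bar>"
      using ae by eventually_elim simp
  qed
qed

definition uniformity_L1 :: "(L1 \<times> L1) filter" where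
  "uniformity_L1 = (INF e\<in>{0 <..}. principal {(x, y). dist x y < e})"

definition open_L1 :: "L1 set \<Rightarrow> bool" where
  "open_L1 U \<longleftrightarrow> (\<forall>x\<in>U. eventually (\<lambda>(x', y). x' = x \<longrightarrow> y \<in> U) uniformity)"

instance
proof
  show "(uniformity :: (L1 \<times> L1) filter) = (INF e\<in>{0 <..}. principal {(x, y). dist x y < e})"
    by (fact uniformity_L1_def)
  show "open U \<longleftrightarrow> (\<forall>x\<in>U. eventually (\<lambda>(x', y). x' = x \<longrightarrow> y \<in> U) uniformity)" for U :: "L1 set"
    by (fact open_L1_def)
  show "dist x y = 0 \<longleftrightarrow> x = y" for x y :: L1
  proof transfer
    fix f g assume "L1_rel f f" "L1_rel g g"
    then have int: "integrable unit_leb f" "integrable unit_leb g"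
      by (auto simp: L1_rel_def)
    then have "integrable unit_leb (\<lambda>x. \<bar>f x - g x\<bar>)"
      by (intro integrable_abs Bochner_Integration.integrable_diff)
    from integral_nonneg_eq_0_iff_AE[OF this]
    show "((\<integral>x. \<bar>f x - g x\<bar> \<partial>unit_leb) = 0) = L1_rel f g"
      using int by (simp add: L1_rel_def)
  qed
  show "dist x y \<le> dist x z + dist y z" for x y z :: L1
  proof transfer
    fix f g h assume "L1_rel f f" "L1_rel g g" "L1_rel h h"
    then have int: "integrable unit_leb f" "integrable unit_leb g" "integrable unit_leb h"
      by (auto simp: L1_rel_def)
    have I: "integrable unit_leb (\<lambda>x. \<bar>u x - v x\<bar>)"
      if "integrable unit_leb u" "integrable unit_leb v" for u v :: "real \<Rightarrow> real"
      using that by (intro integrable_abs Bochner_Integration.integrable_diff)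
    have "(\<integral>x. \<bar>f x - g x\<bar> \<partial>unit_leb) \<le> (\<integral>x. \<bar>f x - h x\<bar> + \<bar>g x - h x\<bar> \<partial>unit_leb)"
      by (rule integral_mono) (use int in \<open>auto intro!: I Bochner_Integration.integrable_add\<close>)
    also have "\<dots> = (\<integral>x. \<bar>f x - h x\<bar> \<partial>unit_leb) + (\<integral>x. \<bar>g x - h x\<bar> \<partial>unit_leb)"
      by (rule Bochner_Integration.integral_add) (use int I in auto)
    finally show "(\<integral>x. \<bar>f x - g x\<bar> \<partial>unit_leb)
        \<le> (\<integral>x. \<bar>f x - h x\<bar> \<partial>unit_leb) + (\<integral>x. \<bar>g x - h x\<bar> \<partial>unit_leb)" .
  qed
qed

end

definition lip_const :: "'a set \<Rightarrow> ('a \<Rightarrow> 'a \<Rightarrow> real) \<Rightarrow> ('b \<Rightarrow> 'b \<Rightarrow> real) \<Rightarrow> ('a \<Rightarrow> 'b) \<Rightarrow> ennreal" where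
  "lip_const X dX dY f =
     (SUP (x, y) \<in> {(x, y). x \<in> X \<and> y \<in> X \<and> x \<noteq> y}. ennreal (dY (f x) (f y) / dX x y))"

definition distortion :: "'a set \<Rightarrow> ('a \<Rightarrow> 'a \<Rightarrow> real) \<Rightarrow> ('b \<Rightarrow> 'b \<Rightarrow> real) \<Rightarrow> ('a \<Rightarrow> 'b) \<Rightarrow> ennreal" where
  "distortion X dX dY f =
     (if inj_on f X then lip_const X dX dY f * lip_const (f ` X) dY dX (inv_into X f) else \<infinity>)"

definition c1 :: "'a set \<Rightarrow> ('a \<Rightarrow> 'a \<Rightarrow> real) \<Rightarrow> ennreal" where
  "c1 X d = (INF f. distortion X d dist (f :: 'a \<Rightarrow> L1))"

text \<open>Edges have identities of their own type; \<open>tail\<close> and \<open>head\<close> record the fixed reference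
  orientation, which matters for composition but not for walks.\<close>

record ('v, 'e) st_graph =
  verts :: "'v set"
  edges :: "'e set"
  tail :: "'e \<Rightarrow> 'v"
  head :: "'e \<Rightarrow> 'v"
  len :: "'e \<Rightarrow> real"
  src :: 'v
  snk :: 'v

inductive walk :: "('v, 'e) st_graph \<Rightarrow> 'v \<Rightarrow> real \<Rightarrow> 'v \<Rightarrow> bool" for G where
  nil: "u \<in> verts G \<Longrightarrow> walk G u 0 u"
| fwd: "e \<in> edges G \<Longrightarrow> walk G (head G e) l w \<Longrightarrow> walk G (tail G e) (len G e + l) w"
| bwd: "e \<in> edges G \<Longrightarrow> walk G (tail G e) l w \<Longrightarrow> walk G (head G e) (len G e + l) w"

text \<open>Meaningful for connected graphs with nonnegative lengths, where the set of lengths of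
  walks is nonempty and bounded below.\<close>

definition sp_dist :: "('v, 'e) st_graph \<Rightarrow> 'v \<Rightarrow> 'v \<Rightarrow> real" where
  "sp_dist G u v = Inf {l. walk G u l v}"

text \<open>All powers of \<open>G\<close> share one vertex type: \<open>Old v\<close> is a vertex \<open>v\<close> of the left factor, and
  \<open>New e x\<close> is the non-terminal vertex \<open>x\<close> of the copy of \<open>G\<close> that replaces the edge \<open>e\<close>.
  The edge coming from \<open>a\<close> in the copy of \<open>G\<close> that replaces \<open>e\<close> is \<open>a # e\<close>.\<close>

datatype ('v, 'e) pvert = Src | Snk | Old "('v, 'e) pvert" | New "'e list" 'v

definition glue ::
  "(('v, 'e) pvert, 'e list) st_graph \<Rightarrow> ('v, 'e) st_graph \<Rightarrow> 'e list \<Rightarrow> 'v \<Rightarrow> ('v, 'e) pvert" where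
  "glue H G e x =
     (if x = src G then Old (tail H e) else if x = snk G then Old (head H e) else New e x)"

definition oslash ::
  "(('v, 'e) pvert, 'e list) st_graph \<Rightarrow> ('v, 'e) st_graph \<Rightarrow> (('v, 'e) pvert, 'e list) st_graph"
  (infixl "\<oslash>" 70) where
  "H \<oslash> G = \<lparr>
     verts = Old ` verts H \<union> {glue H G e x | e x. e \<in> edges H \<and> x \<in> verts G},
     edges = {a # e | a e. a \<in> edges G \<and> e \<in> edges H},
     tail = (\<lambda>b. glue H G (tl b) (tail G (hd b))),
     head = (\<lambda>b. glue H G (tl b) (head G (hd b))),
     len = (\<lambda>b. len G (hd b) * (len H (tl b) / sp_dist G (src G) (snk G))),
     src = Old (src H),
     snk = Old (snk H)\<rparr>"

definition single_edge :: "(('v, 'e) pvert, 'e list) st_graph" where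
  "single_edge = \<lparr>verts = {Src, Snk}, edges = {[]}, tail = (\<lambda>_. Src), head = (\<lambda>_. Snk),
     len = (\<lambda>_. 1), src = Src, snk = Snk\<rparr>"

fun oslash_pow :: "('v, 'e) st_graph \<Rightarrow> nat \<Rightarrow> (('v, 'e) pvert, 'e list) st_graph" where
  "oslash_pow G 0 = single_edge"
| "oslash_pow G (Suc k) = oslash_pow G k \<oslash> G"

definition K2 :: "nat \<Rightarrow> (bool + nat, bool \<times> nat) st_graph" where
  "K2 n = \<lparr>verts = range Inl \<union> Inr ` {..<n}, edges = UNIV \<times> {..<n},
     tail = (\<lambda>(b, i). Inl b), head = (\<lambda>(b, i). Inr i), len = (\<lambda>_. 1),
     src = Inl False, snk = Inl True\<rparr>"

lemma walk_K2_bound: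
  assumes "walk (K2 n) u l v"
  shows "l \<ge> 0 \<and> (u \<noteq> v \<longrightarrow> l \<ge> 1) \<and> (isl u \<and> isl v \<and> u \<noteq> v \<longrightarrow> l \<ge> 2)"
  using assms by induction (auto simp: K2_def)

lemma sp_dist_K2:
  assumes "n \<ge> 1"
  shows "sp_dist (K2 n) (src (K2 n)) (snk (K2 n)) = 2"
proof -
  let ?G = "K2 n"
  have "walk ?G (Inl True) 0 (Inl True)"
    by (rule walk.nil) (simp add: K2_def)
  with walk.bwd[of "(True, 0)" ?G 0 "Inl True"] assms have "walk ?G (Inr 0) 1 (Inl True)"
    by (simp add: K2_def)
  with walk.fwd[of "(False, 0)" ?G 1 "Inl True"] assms have "walk ?G (Inl False) 2 (Inl True)"
    by (simp add: K2_def)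
  then have "Inf {l. walk ?G (Inl False) l (Inl True)} = 2"
    by (intro cInf_eq_minimum) (auto dest: walk_K2_bound)
  then show ?thesis
    by (simp add: sp_dist_def K2_def)
qed

lemma len_K2_pow:
  assumes "n \<ge> 1" "e \<in> edges (oslash_pow (K2 n) k)"
  shows "len (oslash_pow (K2 n) k) e = 1 / 2 ^ k"
  using assms(2)
proof (induction k arbitrary: e)
  case 0
  then show ?case by (simp add: single_edge_def)
next
  case (Suc k)
  then obtain a e' where "e = a # e'" "e' \<in> edges (oslash_pow (K2 n) k)"
    by (auto simp: oslash_def)
  moreover have "len (K2 n) a = 1" by (simp add: K2_def)
  ultimately show ?case
    using Suc.IH assms(1) by (simp add: oslash_def sp_dist_K2)
qed

end

theory Submission
  imports Defs "HOL-Probability.Product_PMF" "HOL-Library.Ramsey"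
begin

text \<open>Let \<open>m = \<lceil>n / 2\<rceil>\<close>. Cut the graph at random from the top down: starting with \<open>s\<close> and \<open>t\<close> on
  different sides, whenever an edge is refined, a uniformly random \<open>m\<close>-element subset of \<open>2m\<close>
  midpoints joins one endpoint and the rest join the other, independently for all edges. An edge at
  level \<open>k\<close> is then separated with probability exactly \<open>2\<^sup>-\<^sup>k\<close>, so the separation probability is an
  \<open>L\<^sub>1\<close> pseudometric bounded by the graph metric. Conversely, two points lying in copies attached to
  opposite terminals at distances \<open>p/2, q/2 \<le> 1/2\<close> on different \<open>s\<close>-\<open>t\<close> paths have distance
  \<open>1 - \<bar>p - q\<bar>/2\<close> and are separated with probability \<open>1 - (p + q)/2 + \<sigma> p q\<close>, where
  \<open>\<sigma> = m/(2m - 1)\<close> is the probability of separating two midpoints; the ratio is smallest at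
  \<open>p = q = 1/(2\<sigma>)\<close>, where it equals \<open>1 - 1/(4\<sigma>) = (2m + 1)/(4m)\<close>. All other pairs are better or
  reduce to a smaller power by self-similarity.\<close>

section \<open>Walks and shortest paths\<close>

lemma walk_trans:
  assumes "walk G u l v" "walk G v l' w"
  shows "walk G u (l + l') w"
  using assms by induction (auto simp: add.assoc intro: walk.intros)

lemma walk_edge:
  assumes "e \<in> edges G" "tail G e \<in> verts G" "head G e \<in> verts G"
  shows "walk G (tail G e) (len G e) (head G e)" "walk G (head G e) (len G e) (tail G e)"
  using walk.fwd[OF assms(1) walk.nil[OF assms(3)]] walk.bwd[OF assms(1) walk.nil[OF assms(2)]]
  by simp_all

lemma walk_sym:
  assumes "walk G u l v" and "\<And>e. e \<in> edges G \<Longrightarrow> tail G e \<in> verts G \<and> head G e \<in> verts G"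
  shows "walk G v l u"
  using assms(1)
proof induction
  case (nil u)
  then show ?case by (rule walk.nil)
next
  case (fwd e l w)
  then show ?case
    using walk_trans[OF fwd.IH walk_edge(2)[of e G]] assms(2) by (simp add: add.commute)
next
  case (bwd e l w)
  then show ?case
    using walk_trans[OF bwd.IH walk_edge(1)[of e G]] assms(2) by (simp add: add.commute)
qed

definition pseudometric :: "('a \<Rightarrow> 'a \<Rightarrow> real) \<Rightarrow> bool" where
  "pseudometric \<rho> \<longleftrightarrow>
     (\<forall>x. \<rho> x x = 0) \<and> (\<forall>x y. \<rho> x y = \<rho> y x) \<and> (\<forall>x y z. \<rho> x z \<le> \<rho> x y + \<rho> y z)"

lemma pseudometric_le_walk:
  assumes "walk G u l v" and \<rho>: "pseudometric \<rho>"
    and edge: "\<And>e. e \<in> edges G \<Longrightarrow> \<rho> (tail G e) (head G e) \<le> len G e"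
  shows "\<rho> u v \<le> l"
  using assms(1)
proof induction
  case (nil u)
  then show ?case using \<rho> by (simp add: pseudometric_def)
next
  case (fwd e l w)
  have "\<rho> (tail G e) w \<le> \<rho> (tail G e) (head G e) + \<rho> (head G e) w"
    using \<rho> unfolding pseudometric_def by blast
  then show ?case using edge[OF fwd.hyps(1)] fwd.IH by simp
next
  case (bwd e l w)
  have "\<rho> (head G e) w \<le> \<rho> (tail G e) (head G e) + \<rho> (tail G e) w"
    using \<rho> unfolding pseudometric_def by metis
  then show ?case using edge[OF bwd.hyps(1)] bwd.IH by simp
qed

lemma pseudometric_le_sp_dist:
  assumes "walk G u l v" "pseudometric \<rho>"
    and "\<And>e. e \<in> edges G \<Longrightarrow> \<rho> (tail G e) (head G e) \<le> len G e"
  shows "\<rho> u v \<le> sp_dist G u v"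
  unfolding sp_dist_def
  using assms(1) by (intro cInf_greatest) (auto intro: pseudometric_le_walk[OF _ assms(2,3)])

lemma sp_dist_le_walk:
  assumes "walk G u l v" and "\<And>e. e \<in> edges G \<Longrightarrow> 0 \<le> len G e"
  shows "sp_dist G u v \<le> l"
proof -
  have "0 \<le> l'" if "walk G u l' v" for l'
    using pseudometric_le_walk[OF that, of "\<lambda>_ _. 0"] assms(2) by (simp add: pseudometric_def)
  then have "bdd_below {l'. walk G u l' v}" by (intro bdd_belowI[of _ 0]) simp
  then show ?thesis
    unfolding sp_dist_def using assms(1) by (auto intro: cInf_lower)
qed

lemma edge_length_bound_le_sp_dist:
  assumes "walk G u l v" "u \<noteq> v" "0 \<le> c" and "\<And>e. e \<in> edges G \<Longrightarrow> c \<le> len G e"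
  shows "c \<le> sp_dist G u v"
proof -
  have "pseudometric (\<lambda>x y. if x = y then 0 else c)"
    using assms(3) by (auto simp: pseudometric_def)
  from pseudometric_le_sp_dist[OF assms(1) this] have "(if u = v then 0 else c) \<le> sp_dist G u v"
    using assms(3,4) by (force intro: order_trans)
  with assms(2) show ?thesis by simp
qed

section \<open>Self-similarity of graph powers\<close>

text \<open>The power \<open>G\<^sup>k\<^sup>+\<^sup>1\<close> is by definition \<open>G\<^sup>k\<close> with every edge refined into \<open>G\<close>; it is also
  \<open>G\<close> with every edge \<open>a\<close> replaced by a rescaled copy of \<open>G\<^sup>k\<close>. The inclusion of that copy
  is \<open>copy_vert G a\<close> on vertices and \<open>e \<mapsto> e @ [a]\<close> on edges; \<open>base_vert G k\<close> includes the vertices of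
  the outer \<open>G\<close>.\<close>

fun copy_vert :: "('v, 'e) st_graph \<Rightarrow> 'e \<Rightarrow> ('v, 'e) pvert \<Rightarrow> ('v, 'e) pvert" where
  "copy_vert G a Src = glue single_edge G [] (tail G a)"
| "copy_vert G a Snk = glue single_edge G [] (head G a)"
| "copy_vert G a (Old v) = Old (copy_vert G a v)"
| "copy_vert G a (New e x) = New (e @ [a]) x"

definition base_vert :: "('v, 'e) st_graph \<Rightarrow> nat \<Rightarrow> 'v \<Rightarrow> ('v, 'e) pvert" where
  "base_vert G k x = (Old ^^ k) (glue single_edge G [] x)"

definition st_dist :: "('v, 'e) st_graph \<Rightarrow> real" where
  "st_dist G = sp_dist G (src G) (snk G)"

definition rel_len :: "('v, 'e) st_graph \<Rightarrow> 'e \<Rightarrow> real" where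
  "rel_len G a = len G a / st_dist G"

lemma oslash_pow_0_simps [simp]:
  "verts (oslash_pow G 0) = {Src, Snk}" "edges (oslash_pow G 0) = {[]}"
  "tail (oslash_pow G 0) e = Src" "head (oslash_pow G 0) e = Snk" "len (oslash_pow G 0) e = 1"
  "glue (oslash_pow G 0) = glue single_edge"
  by (simp_all add: single_edge_def)

lemma oslash_pow_Suc_simps [simp]:
  "edges (oslash_pow G (Suc k)) = {a # e | a e. a \<in> edges G \<and> e \<in> edges (oslash_pow G k)}"
  "tail (oslash_pow G (Suc k)) (a # e) = glue (oslash_pow G k) G e (tail G a)"
  "head (oslash_pow G (Suc k)) (a # e) = glue (oslash_pow G k) G e (head G a)"
  "len (oslash_pow G (Suc k)) (a # e) = rel_len G a * len (oslash_pow G k) e"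
  by (simp_all add: oslash_def rel_len_def st_dist_def)

lemma verts_oslash_pow_Suc:
  "verts (oslash_pow G (Suc k)) = Old ` verts (oslash_pow G k) \<union>
     {glue (oslash_pow G k) G e x | e x. e \<in> edges (oslash_pow G k) \<and> x \<in> verts G}"
  by (simp add: oslash_def)

lemma src_snk_oslash_pow:
  "src (oslash_pow G k) = (Old ^^ k) Src" "snk (oslash_pow G k) = (Old ^^ k) Snk"
  by (induction k) (simp_all add: oslash_def single_edge_def)

declare oslash_pow.simps [simp del]

lemma edges_oslash_pow: "edges (oslash_pow G k) = {e. length e = k \<and> set e \<subseteq> edges G}"
proof (induction k)
  case (Suc k)
  show ?case unfolding oslash_pow_Suc_simps Suc by (auto simp: length_Suc_conv)
qed auto

lemma edges_oslash_pow_Suc_snoc: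
  "edges (oslash_pow G (Suc k)) = {e @ [a] | e a. e \<in> edges (oslash_pow G k) \<and> a \<in> edges G}"
  unfolding edges_oslash_pow by (auto simp: length_Suc_conv_rev)

lemma len_oslash_pow: "length e = k \<Longrightarrow> len (oslash_pow G k) e = (\<Prod>a\<leftarrow>e. rel_len G a)"
  by (induction e arbitrary: k) auto

lemma tail_head_oslash_pow_snoc:
  assumes "length e = k"
  shows "tail (oslash_pow G (Suc k)) (e @ [a]) = copy_vert G a (tail (oslash_pow G k) e)"
    and "head (oslash_pow G (Suc k)) (e @ [a]) = copy_vert G a (head (oslash_pow G k) e)"
  using assms by (induction e arbitrary: k) (auto simp: glue_def single_edge_def)

lemma walk_oslash_pow_0: "walk (oslash_pow G 0) Src 1 Snk" "walk (oslash_pow G 0) Snk 1 Src"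
  using walk_edge[of "[]" "oslash_pow G 0"] by simp_all

lemma copy_vert_glue:
  assumes "length e = k"
  shows "copy_vert G a (glue (oslash_pow G k) G e x) = glue (oslash_pow G (Suc k)) G (e @ [a]) x"
  using tail_head_oslash_pow_snoc[OF assms, of G a]
  by (simp add: glue_def del: oslash_pow_Suc_simps)

lemma copy_vert_src_snk:
  "copy_vert G a (src (oslash_pow G k)) = base_vert G k (tail G a)"
  "copy_vert G a (snk (oslash_pow G k)) = base_vert G k (head G a)"
proof -
  have "copy_vert G a ((Old ^^ k) v) = (Old ^^ k) (copy_vert G a v)" for v
    by (induction k) simp_all
  then show "copy_vert G a (src (oslash_pow G k)) = base_vert G k (tail G a)"
    "copy_vert G a (snk (oslash_pow G k)) = base_vert G k (head G a)"
    by (simp_all add: src_snk_oslash_pow base_vert_def)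
qed

locale two_terminal_graph =
  fixes G :: "('v, 'e) st_graph"
  assumes verts_eq_endpoints: "verts G = tail G ` edges G \<union> head G ` edges G"
    and src_in_verts: "src G \<in> verts G" and snk_in_verts: "snk G \<in> verts G"
    and src_neq_snk: "src G \<noteq> snk G"
begin

abbreviation Gpow :: "nat \<Rightarrow> (('v, 'e) pvert, 'e list) st_graph" where
  "Gpow \<equiv> oslash_pow G"

lemma endpoints_in_verts: "a \<in> edges G \<Longrightarrow> tail G a \<in> verts G" "a \<in> edges G \<Longrightarrow> head G a \<in> verts G"
  by (auto simp: verts_eq_endpoints)

lemma src_snk_in_verts_Gpow: "src (Gpow k) \<in> verts (Gpow k)" "snk (Gpow k) \<in> verts (Gpow k)"
  by (induction k) (simp_all add: src_snk_oslash_pow verts_oslash_pow_Suc)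

lemma glue_in_verts:
  assumes "e \<in> edges (Gpow k)" "x \<in> verts G"
  shows "glue (Gpow k) G e x \<in> verts (Gpow (Suc k))"
  using assms unfolding verts_oslash_pow_Suc by blast

lemma endpoints_in_verts_Gpow:
  assumes "e \<in> edges (Gpow k)"
  shows "tail (Gpow k) e \<in> verts (Gpow k) \<and> head (Gpow k) e \<in> verts (Gpow k)"
proof (cases k)
  case (Suc k')
  then obtain a e' where "e = a # e'" "a \<in> edges G" "e' \<in> edges (Gpow k')"
    using assms by auto
  then show ?thesis using Suc by (simp add: endpoints_in_verts glue_in_verts)
qed simp

lemma walk_sym_Gpow: "walk (Gpow k) u l v \<Longrightarrow> walk (Gpow k) v l u"
  by (rule walk_sym) (auto dest: endpoints_in_verts_Gpow)

lemma base_vert_src_snk: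
  "base_vert G k (src G) = src (Gpow (Suc k))" "base_vert G k (snk G) = snk (Gpow (Suc k))"
  using src_neq_snk
  by (simp_all add: base_vert_def src_snk_oslash_pow glue_def single_edge_def funpow_swap1)

lemma copy_vert_in_verts:
  assumes a_edge: "a \<in> edges G" and "v \<in> verts (Gpow k)"
  shows "copy_vert G a v \<in> verts (Gpow (Suc k))"
  using assms(2)
proof (induction k arbitrary: v)
  case 0
  have "glue single_edge G [] x \<in> verts (Gpow (Suc 0))" if "x \<in> verts G" for x
    using glue_in_verts[of "[]" 0 x] that by simp
  with 0 a_edge show ?case by (auto simp: endpoints_in_verts)
next
  case (Suc k)
  from Suc.prems[unfolded verts_oslash_pow_Suc[of _ k]] consider
      (old) v' where "v = Old v'" "v' \<in> verts (Gpow k)"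
    | (glued) e x where "v = glue (Gpow k) G e x" "e \<in> edges (Gpow k)" "x \<in> verts G"
    by blast
  then show ?case
  proof cases
    case old
    then show ?thesis using Suc.IH by (simp add: verts_oslash_pow_Suc[of _ "Suc k"])
  next
    case glued
    then have "copy_vert G a v = glue (Gpow (Suc k)) G (e @ [a]) x"
      by (simp add: copy_vert_glue edges_oslash_pow)
    moreover have "e @ [a] \<in> edges (Gpow (Suc k))"
      using glued a_edge edges_oslash_pow_Suc_snoc by blast
    ultimately show ?thesis using glue_in_verts[OF _ glued(3)] by metis
  qed
qed

lemma base_vert_in_verts:
  assumes "x \<in> verts G"
  shows "base_vert G k x \<in> verts (Gpow (Suc k))"
  using assms copy_vert_in_verts src_snk_in_verts_Gpow[of k]
  by (auto simp: verts_eq_endpoints copy_vert_src_snk[symmetric])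

lemma verts_Gpow_Suc_subset_copies:
  "verts (Gpow (Suc k)) \<subseteq> (\<Union>a\<in>edges G. copy_vert G a ` verts (Gpow k))" (is "_ \<subseteq> ?copies k")
proof (rule subsetI)
  fix v assume "v \<in> verts (Gpow (Suc k))"
  then show "v \<in> ?copies k"
  proof (induction k arbitrary: v)
    case 0
    have glued_copies: "glue single_edge G [] x \<in> ?copies 0" if "x \<in> verts G" for x
      using that by (auto simp: verts_eq_endpoints)
    have "Old Src = glue single_edge G [] (src G)" "Old Snk = glue single_edge G [] (snk G)"
      using src_neq_snk by (simp_all add: glue_def single_edge_def)
    with 0 show ?case
      using glued_copies src_in_verts snk_in_verts
      by (auto simp: verts_oslash_pow_Suc)
  next
    case (Suc k)
    from Suc.prems[unfolded verts_oslash_pow_Suc[of _ "Suc k"]] consider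
        (old) v' where "v = Old v'" "v' \<in> verts (Gpow (Suc k))"
      | (glued) e x where "v = glue (Gpow (Suc k)) G e x" "e \<in> edges (Gpow (Suc k))" "x \<in> verts G"
      by blast
    then show ?case
    proof cases
      case old
      then obtain a u where "a \<in> edges G" "u \<in> verts (Gpow k)" "v' = copy_vert G a u"
        using Suc.IH by blast
      then have "v = copy_vert G a (Old u)" "Old u \<in> verts (Gpow (Suc k))" "a \<in> edges G"
        using old by (simp_all add: verts_oslash_pow_Suc)
      then show ?thesis by blast
    next
      case glued
      then obtain e' a where e_snoc: "e = e' @ [a]" "e' \<in> edges (Gpow k)" "a \<in> edges G"
        unfolding edges_oslash_pow_Suc_snoc by blast
      then have "v = copy_vert G a (glue (Gpow k) G e' x)"
        using glued by (simp add: copy_vert_glue edges_oslash_pow)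
      then show ?thesis using e_snoc glue_in_verts[OF e_snoc(2) glued(3)] by blast
    qed
  qed
qed

lemma verts_Gpow_Suc_eq_copies:
  "verts (Gpow (Suc k)) = (\<Union>a\<in>edges G. copy_vert G a ` verts (Gpow k))"
  using verts_Gpow_Suc_subset_copies copy_vert_in_verts by blast

lemma walk_copy_vert:
  assumes a_edge: "a \<in> edges G" and "walk (Gpow k) u l v"
  shows "walk (Gpow (Suc k)) (copy_vert G a u) (rel_len G a * l) (copy_vert G a v)"
  using assms(2)
proof induction
  case (nil u)
  then show ?case using copy_vert_in_verts[OF a_edge] by (simp add: walk.nil)
next
  case (fwd e l w)
  from fwd.hyps(1) a_edge have "e @ [a] \<in> edges (Gpow (Suc k))" and length_e: "length e = k"
    by (auto simp: edges_oslash_pow)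
  from walk.fwd[OF this(1)] fwd.IH show ?case
    by (simp add: tail_head_oslash_pow_snoc[OF length_e] len_oslash_pow length_e algebra_simps
        del: oslash_pow_Suc_simps)
next
  case (bwd e l w)
  from bwd.hyps(1) a_edge have "e @ [a] \<in> edges (Gpow (Suc k))" and length_e: "length e = k"
    by (auto simp: edges_oslash_pow)
  from walk.bwd[OF this(1)] bwd.IH show ?case
    by (simp add: tail_head_oslash_pow_snoc[OF length_e] len_oslash_pow length_e algebra_simps
        del: oslash_pow_Suc_simps)
qed

lemma walk_base_vert:
  assumes walk_src_snk: "walk (Gpow k) (src (Gpow k)) 1 (snk (Gpow k))" and "walk G x l y"
  shows "walk (Gpow (Suc k)) (base_vert G k x) (l / st_dist G) (base_vert G k y)"
  using assms(2)
proof induction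
  case (nil x)
  then show ?case using base_vert_in_verts by (simp add: walk.nil)
next
  case (fwd a l y)
  from walk_trans[OF walk_copy_vert[OF fwd.hyps(1) walk_src_snk] fwd.IH[folded copy_vert_src_snk]]
  show ?case
    by (simp add: copy_vert_src_snk rel_len_def add_divide_distrib)
next
  case (bwd a l y)
  from walk_trans[OF walk_copy_vert[OF bwd.hyps(1) walk_sym_Gpow[OF walk_src_snk]]
      bwd.IH[folded copy_vert_src_snk]]
  show ?case
    by (simp add: copy_vert_src_snk rel_len_def add_divide_distrib)
qed

lemma walk_Gpow_src_snk:
  assumes "walk G (src G) (st_dist G) (snk G)" "st_dist G \<noteq> 0"
  shows "walk (Gpow k) (src (Gpow k)) 1 (snk (Gpow k))"
proof (induction k)
  case 0
  show ?case by (simp add: src_snk_oslash_pow walk_oslash_pow_0)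
next
  case (Suc k)
  from walk_base_vert[OF this assms(1)] assms(2) show ?case
    by (simp add: base_vert_src_snk)
qed

end

section \<open>Random cuts\<close>

definition mem_prob :: "'a set pmf \<Rightarrow> 'a \<Rightarrow> real" where
  "mem_prob M x = measure_pmf.prob M {A. x \<in> A}"

definition split_prob :: "'a set pmf \<Rightarrow> 'a \<Rightarrow> 'a \<Rightarrow> real" where
  "split_prob M x y = measure_pmf.prob M {A. (x \<in> A) \<noteq> (y \<in> A)}"

lemma mem_prob_bounds: "0 \<le> mem_prob M x" "mem_prob M x \<le> 1"
  by (simp_all add: mem_prob_def)

lemma prob_notmem: "measure_pmf.prob M {A. x \<notin> A} = 1 - mem_prob M x"
  using measure_pmf.prob_neg[of M "\<lambda>A. x \<in> A"] by (simp add: mem_prob_def)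

lemma split_prob_commute: "split_prob M x y = split_prob M y x"
  by (simp add: split_prob_def eq_commute)

lemma pseudometric_split_prob: "pseudometric (split_prob M)"
  unfolding pseudometric_def
proof (intro conjI allI)
  fix x y z
  show "split_prob M x x = 0" by (simp add: split_prob_def)
  show "split_prob M x y = split_prob M y x" by (rule split_prob_commute)
  have "split_prob M x z
      \<le> measure_pmf.prob M ({A. (x \<in> A) \<noteq> (y \<in> A)} \<union> {A. (y \<in> A) \<noteq> (z \<in> A)})"
    unfolding split_prob_def by (intro measure_pmf.finite_measure_mono) auto
  also have "\<dots> \<le> split_prob M x y + split_prob M y z"
    unfolding split_prob_def by (intro measure_Un_le) auto
  finally show "split_prob M x z \<le> split_prob M x y + split_prob M y z" .
qed

lemma prob_pair_pmf_Times:
  "measure_pmf.prob (pair_pmf M N) (A \<times> B) = measure_pmf.prob M A * measure_pmf.prob N B"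
proof -
  have "measure_pmf.prob (pair_pmf M N) (A \<times> B)
      = measure_pmf.prob (pair_pmf M N) ((A \<times> B) \<inter> set_pmf (pair_pmf M N))"
    by (simp only: measure_Int_set_pmf)
  also have "(A \<times> B) \<inter> set_pmf (pair_pmf M N) = (A \<inter> set_pmf M) \<times> (B \<inter> set_pmf N)"
    by auto
  also have "measure_pmf.prob (pair_pmf M N) \<dots> = measure_pmf.prob M A * measure_pmf.prob N B"
    by (subst measure_pmf_prob_product) (auto simp: measure_Int_set_pmf)
  finally show ?thesis .
qed

lemma prob_pair_pmf_total:
  fixes X :: "'b \<Rightarrow> 's::finite"
  shows "measure_pmf.prob (pair_pmf M N) {z. P (X (snd z)) (fst z)} =
    (\<Sum>s\<in>UNIV. measure_pmf.prob N {c. X c = s} * measure_pmf.prob M {A. P s A})"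
proof -
  have "{z. P (X (snd z)) (fst z)} = (\<Union>s. {A. P s A} \<times> {c. X c = s})"
    by auto
  moreover have "disjoint_family (\<lambda>s. {A. P s A} \<times> {c. X c = s})"
    by (auto simp: disjoint_family_on_def)
  ultimately show ?thesis
    by (simp add: measure_pmf.finite_measure_finite_Union prob_pair_pmf_Times mult.commute)
qed

lemma prob_Pi_pmf_two_components:
  assumes "finite I" "i \<in> I" "j \<in> I" "i \<noteq> j"
  shows "measure_pmf.prob (Pi_pmf I d N) {f. f i \<in> S \<and> f j \<in> T}
    = measure_pmf.prob (N i) S * measure_pmf.prob (N j) T"
proof -
  let ?B = "\<lambda>x. if x = i then S else if x = j then T else UNIV"
  have "{f. f i \<in> S \<and> f j \<in> T} = Pi I ?B"
    using assms by (auto simp: Pi_def split: if_splits)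
  then have "measure_pmf.prob (Pi_pmf I d N) {f. f i \<in> S \<and> f j \<in> T}
      = (\<Prod>x\<in>I. measure_pmf.prob (N x) (?B x))"
    using assms(1) by (simp add: measure_Pi_pmf_Pi)
  also have "\<dots> = (\<Prod>x\<in>{i, j}. measure_pmf.prob (N x) (?B x))"
    using assms by (intro prod.mono_neutral_right) auto
  finally show ?thesis using assms(4) by simp
qed

lemma prob_Pi_pmf_component:
  assumes "finite I" "i \<in> I"
  shows "measure_pmf.prob (Pi_pmf I d N) {f. f i \<in> S} = measure_pmf.prob (N i) S"
  using measure_map_pmf[of "\<lambda>f. f i" "Pi_pmf I d N" S]
    Pi_pmf_component[OF assms(1), of i d N] assms(2)
  by (simp add: vimage_def)

text \<open>A random cut of \<open>G\<^sup>k\<close> is assembled from independent cuts of the copies of \<open>G\<close>: \<open>\<omega> e\<close> is the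
  sink side of the copy that replaces the edge \<open>e\<close>. The vertex \<open>x\<close> of that copy follows the head of
  \<open>e\<close> if \<open>x \<in> \<omega> e\<close> and the tail otherwise, where the endpoints of \<open>e = a # e'\<close> are vertices of the
  copy that replaces \<open>e'\<close>.\<close>

definition endpoint :: "('v, 'e) st_graph \<Rightarrow> 'e \<Rightarrow> bool \<Rightarrow> 'v" where
  "endpoint G a s = (if s then head G a else tail G a)"

fun sink_side :: "('v, 'e) st_graph \<Rightarrow> ('e list \<Rightarrow> 'v set) \<Rightarrow> 'e list \<Rightarrow> 'v \<Rightarrow> bool" where
  "sink_side G \<omega> [] x \<longleftrightarrow> x \<in> \<omega> []"
| "sink_side G \<omega> (a # e) x \<longleftrightarrow> sink_side G \<omega> e (endpoint G a (x \<in> \<omega> (a # e)))"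

primrec in_cut :: "('v, 'e) st_graph \<Rightarrow> ('e list \<Rightarrow> 'v set) \<Rightarrow> ('v, 'e) pvert \<Rightarrow> bool" where
  "in_cut G \<omega> Src \<longleftrightarrow> False"
| "in_cut G \<omega> Snk \<longleftrightarrow> True"
| "in_cut G \<omega> (Old v) \<longleftrightarrow> in_cut G \<omega> v"
| "in_cut G \<omega> (New e x) \<longleftrightarrow> sink_side G \<omega> e x"

definition join_choices :: "'v set \<Rightarrow> ('e \<Rightarrow> 'e list \<Rightarrow> 'v set) \<Rightarrow> 'e list \<Rightarrow> 'v set" where
  "join_choices A c e = (if e = [] then A else c (last e) (butlast e))"

lemma join_choices_Nil: "join_choices A c [] = A"
  and join_choices_snoc: "join_choices A c (e @ [a]) = c a e"
  by (simp_all add: join_choices_def)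

lemma sink_side_join_choices:
  "sink_side G (join_choices A c) (e @ [a]) x \<longleftrightarrow> endpoint G a (sink_side G (c a) e x) \<in> A"
proof (induction e arbitrary: x)
  case Nil
  show ?case using join_choices_snoc[of A c "[]"] by (simp add: join_choices_Nil)
next
  case (Cons b e)
  then show ?case using join_choices_snoc[of A c "b # e"] by simp
qed

lemma in_cut_join_choices:
  assumes "src G \<notin> A" "snk G \<in> A"
  shows "in_cut G (join_choices A c) (copy_vert G a v) \<longleftrightarrow> endpoint G a (in_cut G (c a) v) \<in> A"
proof (induction v)
  case (New e x)
  show ?case by (simp add: sink_side_join_choices)
qed (use assms in \<open>auto simp: glue_def single_edge_def endpoint_def join_choices_Nil\<close>)

locale random_st_cut = two_terminal_graph G for G :: "('v, 'e) st_graph" +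
  fixes M :: "'v set pmf"
  assumes finite_edges: "finite (edges G)" and finite_cuts: "finite (set_pmf M)"
    and separates_src_snk: "A \<in> set_pmf M \<Longrightarrow> src G \<notin> A \<and> snk G \<in> A"
begin

primrec choices_pmf :: "nat \<Rightarrow> ('e list \<Rightarrow> 'v set) pmf" where
  "choices_pmf 0 = return_pmf (\<lambda>_. {})"
| "choices_pmf (Suc k) = map_pmf (\<lambda>(A, c). join_choices A c)
     (pair_pmf M (Pi_pmf (edges G) (\<lambda>_. {}) (\<lambda>_. choices_pmf k)))"

definition cut_pmf :: "nat \<Rightarrow> ('v, 'e) pvert set pmf" where
  "cut_pmf k = map_pmf (\<lambda>\<omega>. Collect (in_cut G \<omega>)) (choices_pmf k)"

lemma finite_set_cut_pmf: "finite (set_pmf (cut_pmf k))"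
proof -
  have "finite (set_pmf (choices_pmf k))"
  proof (induction k)
    case (Suc k)
    then have "finite (set_pmf (Pi_pmf (edges G) (\<lambda>_. {}) (\<lambda>_. choices_pmf k)))"
      by (auto simp: set_Pi_pmf finite_edges intro: finite_PiE_dflt)
    then show ?case by (simp add: finite_cuts)
  qed simp
  then show ?thesis by (simp add: cut_pmf_def)
qed

lemma mem_prob_cut_pmf_0: "mem_prob (cut_pmf 0) Src = 0" "mem_prob (cut_pmf 0) Snk = 1"
  by (simp_all add: mem_prob_def cut_pmf_def)

lemma split_prob_cut_pmf_0: "split_prob (cut_pmf 0) Src Snk = 1"
  by (simp add: split_prob_def cut_pmf_def)

lemma prob_mem_cut_pmf:
  "measure_pmf.prob (cut_pmf k) {B. (u \<in> B) = s} =
    (if s then mem_prob (cut_pmf k) u else 1 - mem_prob (cut_pmf k) u)"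
  using prob_notmem[of "cut_pmf k" u] by (simp add: mem_prob_def)

text \<open>The value of \<open>copy_cuts_pmf\<close> outside the edges is the image of that in \<open>choices_pmf\<close>.\<close>

definition copy_cuts_pmf :: "nat \<Rightarrow> ('e \<Rightarrow> ('v, 'e) pvert set) pmf" where
  "copy_cuts_pmf k = Pi_pmf (edges G) (Collect (in_cut G (\<lambda>_. {}))) (\<lambda>_. cut_pmf k)"

lemma prob_cut_pmf_Suc:
  "measure_pmf.prob (cut_pmf (Suc k)) {B. Q (copy_vert G a u \<in> B) (copy_vert G a' v \<in> B)} =
    (\<Sum>s\<in>UNIV. \<Sum>t\<in>UNIV.
      measure_pmf.prob (copy_cuts_pmf k) {C. (u \<in> C a) = s \<and> (v \<in> C a') = t} *
      measure_pmf.prob M {A. Q (endpoint G a s \<in> A) (endpoint G a' t \<in> A)})"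
proof -
  let ?N = "Pi_pmf (edges G) (\<lambda>_. {}) (\<lambda>_. choices_pmf k)"
  let ?X = "\<lambda>c. (in_cut G (c a) u, in_cut G (c a') v)"
  let ?P = "\<lambda>(s, t) A. Q (endpoint G a s \<in> A) (endpoint G a' t \<in> A)"
  have copy_cuts: "measure_pmf.prob (copy_cuts_pmf k) {C. (u \<in> C a) = s \<and> (v \<in> C a') = t} =
      measure_pmf.prob ?N {c. ?X c = (s, t)}" for s t
  proof -
    have "copy_cuts_pmf k = map_pmf (\<lambda>c. (\<lambda>\<omega>. Collect (in_cut G \<omega>)) \<circ> c) ?N"
      unfolding copy_cuts_pmf_def cut_pmf_def by (rule Pi_pmf_map) (auto simp: finite_edges)
    then show ?thesis by (simp add: vimage_def)
  qed
  have "measure_pmf.prob (cut_pmf (Suc k)) {B. Q (copy_vert G a u \<in> B) (copy_vert G a' v \<in> B)} =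
      measure_pmf.prob (pair_pmf M ?N) 
        {z. Q (in_cut G (join_choices (fst z) (snd z)) (copy_vert G a u))
          (in_cut G (join_choices (fst z) (snd z)) (copy_vert G a' v))}"
    by (simp add: cut_pmf_def vimage_def case_prod_unfold)
  also have "\<dots> = measure_pmf.prob (pair_pmf M ?N) {z. ?P (?X (snd z)) (fst z)}"
    by (intro measure_pmf.finite_measure_eq_AE)
      (auto simp: AE_measure_pmf_iff in_cut_join_choices separates_src_snk)
  also have "\<dots> = (\<Sum>s\<in>UNIV. measure_pmf.prob ?N {c. ?X c = s} * measure_pmf.prob M {A. ?P s A})"
    by (rule prob_pair_pmf_total)
  finally show ?thesis
    unfolding copy_cuts sum.cartesian_product by (simp add: case_prod_unfold prod_eq_iff)
qed

lemma mem_prob_copy_vert: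
  assumes "a \<in> edges G"
  shows "mem_prob (cut_pmf (Suc k)) (copy_vert G a u) =
    (1 - mem_prob (cut_pmf k) u) * mem_prob M (tail G a) +
    mem_prob (cut_pmf k) u * mem_prob M (head G a)"
proof -
  have copies: "measure_pmf.prob (copy_cuts_pmf k) {C. (u \<in> C a) = s \<and> (u \<in> C a) = t} =
      (if s = t then if s then mem_prob (cut_pmf k) u else 1 - mem_prob (cut_pmf k) u else 0)"
    for s t
    using prob_Pi_pmf_component[OF finite_edges assms, of _ "\<lambda>_. cut_pmf k" "{B. (u \<in> B) = s}"]
      prob_mem_cut_pmf[of k u s]
    by (cases s; cases t) (simp_all add: copy_cuts_pmf_def)
  show ?thesis
    unfolding mem_prob_def[of "cut_pmf (Suc k)"]
      prob_cut_pmf_Suc[where Q = "\<lambda>p _. p" and a' = a and v = u]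
      copies mem_prob_def[of M, symmetric]
    by (simp add: UNIV_bool endpoint_def)
qed

lemma split_prob_same_copy:
  assumes "a \<in> edges G"
  shows "split_prob (cut_pmf (Suc k)) (copy_vert G a u) (copy_vert G a v) =
    split_prob M (tail G a) (head G a) * split_prob (cut_pmf k) u v"
proof -
  let ?p = "\<lambda>s t. measure_pmf.prob (cut_pmf k) {B. (u \<in> B) = s \<and> (v \<in> B) = t}"
  have "measure_pmf.prob (copy_cuts_pmf k) {C. (u \<in> C a) = s \<and> (v \<in> C a) = t} = ?p s t" for s t
    using prob_Pi_pmf_component[OF finite_edges assms, of _ "\<lambda>_. cut_pmf k"
        "{B. (u \<in> B) = s \<and> (v \<in> B) = t}"]
    by (simp add: copy_cuts_pmf_def)
  then have "split_prob (cut_pmf (Suc k)) (copy_vert G a u) (copy_vert G a v) =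
      split_prob M (tail G a) (head G a) * (?p False True + ?p True False)"
    unfolding split_prob_def[of "cut_pmf (Suc k)"] prob_cut_pmf_Suc[where Q = "(\<noteq>)"]
    using split_prob_commute[of M "head G a"]
    by (simp add: UNIV_bool endpoint_def split_prob_def[of M] algebra_simps)
  also have "?p False True + ?p True False = split_prob (cut_pmf k) u v"
    unfolding split_prob_def
    by (subst measure_pmf.finite_measure_Union[symmetric])
      (auto intro: arg_cong[where f = "measure_pmf.prob (cut_pmf k)"])
  finally show ?thesis .
qed

lemma split_prob_different_copies:
  fixes k u v
  assumes "a \<in> edges G" "a' \<in> edges G" "a \<noteq> a'"
  defines "p \<equiv> mem_prob (cut_pmf k) u" and "q \<equiv> mem_prob (cut_pmf k) v"
  shows "split_prob (cut_pmf (Suc k)) (copy_vert G a u) (copy_vert G a' v) =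
    (1 - p) * (1 - q) * split_prob M (tail G a) (tail G a') +
    (1 - p) * q * split_prob M (tail G a) (head G a') +
    p * (1 - q) * split_prob M (head G a) (tail G a') +
    p * q * split_prob M (head G a) (head G a')"
proof -
  have copies: "measure_pmf.prob (copy_cuts_pmf k) {C. (u \<in> C a) = s \<and> (v \<in> C a') = t} =
      (if s then p else 1 - p) * (if t then q else 1 - q)" for s t
    using prob_Pi_pmf_two_components[OF finite_edges assms(1-3), of _ "\<lambda>_. cut_pmf k"
        "{B. (u \<in> B) = s}" "{B. (v \<in> B) = t}"]
    by (simp add: copy_cuts_pmf_def prob_mem_cut_pmf p_def q_def)
  show ?thesis
    unfolding split_prob_def[of "cut_pmf (Suc k)"]
      prob_cut_pmf_Suc[where Q = "(\<noteq>)"] copies split_prob_def[of M, symmetric]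
    by (simp add: UNIV_bool endpoint_def)
qed

end

section \<open>Geodesic cuts\<close>

text \<open>The distance of a vertex from the source, relative to that of the sink, is its probability of
  being cut off from the source. This condition is inherited by all powers.\<close>

locale geodesic_st_cut = random_st_cut +
  assumes st_dist_nonzero: "st_dist G \<noteq> 0"
    and walk_from_src: "x \<in> verts G \<Longrightarrow> walk G (src G) (mem_prob M x * st_dist G) x"
    and walk_to_snk: "x \<in> verts G \<Longrightarrow> walk G x ((1 - mem_prob M x) * st_dist G) (snk G)"
    and rel_len_eq_mem_prob_diff:
      "a \<in> edges G \<Longrightarrow> rel_len G a = \<bar>mem_prob M (head G a) - mem_prob M (tail G a)\<bar>"
    and split_prob_edge: "a \<in> edges G \<Longrightarrow> split_prob M (tail G a) (head G a) = rel_len G a"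
begin

lemma split_prob_edge_Gpow:
  assumes "e \<in> edges (Gpow k)"
  shows "split_prob (cut_pmf k) (tail (Gpow k) e) (head (Gpow k) e) = len (Gpow k) e"
  using assms
proof (induction k arbitrary: e)
  case 0
  then show ?case by (simp add: split_prob_cut_pmf_0)
next
  case (Suc k)
  then obtain e' a where e_snoc: "e = e' @ [a]" "e' \<in> edges (Gpow k)" "a \<in> edges G"
    unfolding edges_oslash_pow_Suc_snoc by blast
  then have "length e' = k" by (simp add: edges_oslash_pow)
  with e_snoc Suc.IH[OF e_snoc(2)] show ?case
    by (simp add: tail_head_oslash_pow_snoc split_prob_same_copy split_prob_edge len_oslash_pow
        del: oslash_pow_Suc_simps)
qed

lemma split_prob_le_sp_dist:
  assumes "walk (Gpow k) u l v"
  shows "split_prob (cut_pmf k) u v \<le> sp_dist (Gpow k) u v"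
  by (rule pseudometric_le_sp_dist[OF assms pseudometric_split_prob])
    (simp add: split_prob_edge_Gpow)

lemma walk_base_vert_from_src_to_snk:
  assumes "x \<in> verts G"
  shows "walk (Gpow (Suc k)) (src (Gpow (Suc k))) (mem_prob M x) (base_vert G k x)"
    and "walk (Gpow (Suc k)) (base_vert G k x) (1 - mem_prob M x) (snk (Gpow (Suc k)))"
proof -
  have "mem_prob M (snk G) = 1"
    using separates_src_snk by (auto simp: mem_prob_def measure_pmf.prob_eq_1 AE_measure_pmf_iff)
  then have "walk G (src G) (st_dist G) (snk G)"
    using walk_from_src[OF snk_in_verts] by simp
  note walk_base = walk_base_vert[OF walk_Gpow_src_snk[OF this st_dist_nonzero]]
  show "walk (Gpow (Suc k)) (src (Gpow (Suc k))) (mem_prob M x) (base_vert G k x)"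
    using walk_base[OF walk_from_src[OF assms]] st_dist_nonzero by (simp add: base_vert_src_snk)
  show "walk (Gpow (Suc k)) (base_vert G k x) (1 - mem_prob M x) (snk (Gpow (Suc k)))"
    using walk_base[OF walk_to_snk[OF assms]] st_dist_nonzero by (simp add: base_vert_src_snk)
qed

lemma walk_copy_vert_from_src_to_snk:
  fixes k u
  defines "h \<equiv> mem_prob (cut_pmf k) u"
  assumes a_edge: "a \<in> edges G"
    and src_u: "walk (Gpow k) (src (Gpow k)) h u"
    and u_snk: "walk (Gpow k) u (1 - h) (snk (Gpow k))"
  defines "w \<equiv> copy_vert G a u"
  shows "walk (Gpow (Suc k)) (src (Gpow (Suc k))) (mem_prob (cut_pmf (Suc k)) w) w"
    and "walk (Gpow (Suc k)) w (1 - mem_prob (cut_pmf (Suc k)) w) (snk (Gpow (Suc k)))"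
proof -
  let ?t = "mem_prob M (tail G a)" and ?d = "mem_prob M (head G a)"
  have mem_prob_w: "mem_prob (cut_pmf (Suc k)) w = (1 - h) * ?t + h * ?d"
    by (simp add: w_def h_def mem_prob_copy_vert a_edge)
  have tail_w: "walk (Gpow (Suc k)) (base_vert G k (tail G a)) (rel_len G a * h) w"
    and w_head: "walk (Gpow (Suc k)) w (rel_len G a * (1 - h)) (base_vert G k (head G a))"
    using walk_copy_vert[OF a_edge src_u] walk_copy_vert[OF a_edge u_snk]
    by (simp_all add: w_def copy_vert_src_snk)
  note src_tail = walk_base_vert_from_src_to_snk(1)[OF endpoints_in_verts(1)[OF a_edge]]
    and src_head = walk_base_vert_from_src_to_snk(1)[OF endpoints_in_verts(2)[OF a_edge]]
    and tail_snk = walk_base_vert_from_src_to_snk(2)[OF endpoints_in_verts(1)[OF a_edge]]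
    and head_snk = walk_base_vert_from_src_to_snk(2)[OF endpoints_in_verts(2)[OF a_edge]]
  consider (upward) "rel_len G a = ?d - ?t" | (downward) "rel_len G a = ?t - ?d"
    using rel_len_eq_mem_prob_diff[OF a_edge] by linarith
  then have "walk (Gpow (Suc k)) (src (Gpow (Suc k))) (mem_prob (cut_pmf (Suc k)) w) w \<and>
    walk (Gpow (Suc k)) w (1 - mem_prob (cut_pmf (Suc k)) w) (snk (Gpow (Suc k)))"
  proof cases
    case upward
    have "mem_prob (cut_pmf (Suc k)) w = ?t + rel_len G a * h"
      "1 - mem_prob (cut_pmf (Suc k)) w = rel_len G a * (1 - h) + (1 - ?d)"
      unfolding mem_prob_w upward by algebra+
    then show ?thesis
      using walk_trans[OF src_tail tail_w] walk_trans[OF w_head head_snk] by (simp only: simp_thms)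
  next
    case downward
    have "mem_prob (cut_pmf (Suc k)) w = ?d + rel_len G a * (1 - h)"
      "1 - mem_prob (cut_pmf (Suc k)) w = rel_len G a * h + (1 - ?t)"
      unfolding mem_prob_w downward by algebra+
    then show ?thesis
      using walk_trans[OF src_head walk_sym_Gpow[OF w_head]]
        walk_trans[OF walk_sym_Gpow[OF tail_w] tail_snk] by (simp only: simp_thms)
  qed
  then show "walk (Gpow (Suc k)) (src (Gpow (Suc k))) (mem_prob (cut_pmf (Suc k)) w) w"
    "walk (Gpow (Suc k)) w (1 - mem_prob (cut_pmf (Suc k)) w) (snk (Gpow (Suc k)))"
    by simp_all
qed

lemma walk_Gpow_from_src_to_snk:
  assumes "u \<in> verts (Gpow k)"
  shows "walk (Gpow k) (src (Gpow k)) (mem_prob (cut_pmf k) u) u \<and>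
    walk (Gpow k) u (1 - mem_prob (cut_pmf k) u) (snk (Gpow k))"
  using assms
proof (induction k arbitrary: u)
  case 0
  then show ?case
    by (auto simp: src_snk_oslash_pow mem_prob_cut_pmf_0 walk_oslash_pow_0 walk.nil)
next
  case (Suc k)
  then obtain a u' where "a \<in> edges G" "u' \<in> verts (Gpow k)" "u = copy_vert G a u'"
    by (auto simp: verts_Gpow_Suc_eq_copies)
  then show ?case
    using walk_copy_vert_from_src_to_snk[of a k u'] Suc.IH[of u'] by blast
qed

lemma walk_copy_vert_from_tail_to_head:
  assumes "a \<in> edges G" "u \<in> verts (Gpow k)"
  shows "walk (Gpow (Suc k)) (base_vert G k (tail G a))
      (rel_len G a * mem_prob (cut_pmf k) u) (copy_vert G a u)"
    and "walk (Gpow (Suc k)) (copy_vert G a u)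
      (rel_len G a * (1 - mem_prob (cut_pmf k) u)) (base_vert G k (head G a))"
  using walk_copy_vert[OF assms(1)] walk_Gpow_from_src_to_snk[OF assms(2)]
  by (auto simp flip: copy_vert_src_snk)

lemma walk_base_vert_edge:
  assumes "a \<in> edges G"
  shows "walk (Gpow (Suc k)) (base_vert G k (tail G a)) (rel_len G a) (base_vert G k (head G a))"
  using walk_trans[OF walk_copy_vert_from_tail_to_head(1)[OF assms src_snk_in_verts_Gpow(1)]
      walk_copy_vert_from_tail_to_head(2)[OF assms src_snk_in_verts_Gpow(1)]]
  by (simp add: algebra_simps)

end

section \<open>Random cuts of \<open>K\<^bsub>2,n\<^esub>\<close>\<close>

lemma card_nsets_mem:
  assumes "finite U" "i \<in> U"
  shows "card U * card {A \<in> [U]\<^bsup>r\<^esup>. i \<in> A} = r * card ([U]\<^bsup>r\<^esup>)"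
proof (cases r)
  case 0
  then show ?thesis by simp
next
  case (Suc s)
  have "{A \<in> [U]\<^bsup>r\<^esup>. i \<in> A} = insert i ` [U - {i}]\<^bsup>s\<^esup>"
  proof (intro equalityI subsetI)
    fix A assume "A \<in> {A \<in> [U]\<^bsup>r\<^esup>. i \<in> A}"
    then have "A = insert i (A - {i})" "A - {i} \<in> [U - {i}]\<^bsup>s\<^esup>"
      by (auto simp: nsets_def Suc)
    then show "A \<in> insert i ` [U - {i}]\<^bsup>s\<^esup>" by blast
  next
    fix A assume "A \<in> insert i ` [U - {i}]\<^bsup>s\<^esup>"
    then show "A \<in> {A \<in> [U]\<^bsup>r\<^esup>. i \<in> A}"
      using assms(2) by (auto simp: nsets_def Suc card_insert_if)
  qed
  moreover have "inj_on (insert i) ([U - {i}]\<^bsup>s\<^esup>)"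
    by (rule inj_on_inverseI[of _ "\<lambda>A. A - {i}"]) (auto simp: nsets_def)
  ultimately have "card {A \<in> [U]\<^bsup>r\<^esup>. i \<in> A} = (card U - 1) choose s"
    using assms by (simp add: card_image card_nsets)
  moreover have "card U > 0" using assms by (auto simp: card_gt_0_iff)
  ultimately show ?thesis
    using Suc_times_binomial[of s "card U - 1"] by (simp add: Suc card_nsets)
qed

lemma prob_random_nset:
  assumes "finite U" "r \<le> card U"
  shows "measure_pmf.prob (pmf_of_set ([U]\<^bsup>r\<^esup>)) {A. P A} =
    real (card {A \<in> [U]\<^bsup>r\<^esup>. P A}) / real (card U choose r)"
proof -
  have "finite ([U]\<^bsup>r\<^esup>)" "[U]\<^bsup>r\<^esup> \<noteq> {}"
    using assms by (simp_all add: finite_imp_finite_nsets nsets_eq_empty_iff)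
  then show ?thesis by (simp add: measure_pmf_of_set card_nsets Int_def)
qed

lemma mem_prob_random_nset:
  assumes "finite U" "i \<in> U" "r \<le> card U"
  shows "mem_prob (pmf_of_set ([U]\<^bsup>r\<^esup>)) i = real r / real (card U)"
proof -
  have "real (card U) * real (card {A \<in> [U]\<^bsup>r\<^esup>. i \<in> A}) = real r * real (card U choose r)"
    using card_nsets_mem[OF assms(1,2), of r] by (simp only: of_nat_mult[symmetric] card_nsets)
  moreover have "card U choose r > 0" "card U > 0"
    using assms by (auto simp: card_gt_0_iff)
  ultimately show ?thesis
    unfolding mem_prob_def prob_random_nset[OF assms(1,3)] by (simp add: field_simps)
qed

lemma card_nsets_mem_notmem:
  assumes "finite U" "i \<in> U" "j \<in> U" "i \<noteq> j"
  shows "card U * (card U - 1) * card {A \<in> [U]\<^bsup>r\<^esup>. i \<in> A \<and> j \<notin> A} =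
    r * (card U - r) * card ([U]\<^bsup>r\<^esup>)"
proof -
  have "{A \<in> [U]\<^bsup>r\<^esup>. i \<in> A \<and> j \<notin> A} = {A \<in> [U - {j}]\<^bsup>r\<^esup>. i \<in> A}"
    by (auto simp: nsets_def)
  then have "(card U - 1) * card {A \<in> [U]\<^bsup>r\<^esup>. i \<in> A \<and> j \<notin> A} = r * ((card U - 1) choose r)"
    using card_nsets_mem[of "U - {j}" i r] assms by (simp add: card_nsets)
  then have "card U * (card U - 1) * card {A \<in> [U]\<^bsup>r\<^esup>. i \<in> A \<and> j \<notin> A} =
      r * (card U * ((card U - 1) choose r))"
    by (simp only: mult.assoc mult.left_commute[of r])
  also have "card U * ((card U - 1) choose r) = (card U - r) * card ([U]\<^bsup>r\<^esup>)"
    by (simp only: card_nsets binomial_absorb_comp)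
  finally show ?thesis by (simp only: mult.assoc)
qed

lemma split_prob_random_nset:
  assumes "finite U" "i \<in> U" "j \<in> U" "i \<noteq> j" "r \<le> card U"
  shows "split_prob (pmf_of_set ([U]\<^bsup>r\<^esup>)) i j =
    2 * real r * (real (card U) - real r) / (real (card U) * (real (card U) - 1))"
proof -
  let ?N = "card U" and ?sep = "\<lambda>i j. {A \<in> [U]\<^bsup>r\<^esup>. i \<in> A \<and> j \<notin> A}"
  have "1 < ?N" using assms card_mono[of U "{i, j}"] by simp
  have "card {A \<in> [U]\<^bsup>r\<^esup>. (i \<in> A) \<noteq> (j \<in> A)} = card (?sep i j \<union> ?sep j i)"
    by (rule arg_cong[where f = card]) auto
  also have "\<dots> = card (?sep i j) + card (?sep j i)"
    using assms(1) by (intro card_Un_disjoint) (auto simp: finite_imp_finite_nsets)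
  finally have "?N * (?N - 1) * card {A \<in> [U]\<^bsup>r\<^esup>. (i \<in> A) \<noteq> (j \<in> A)} =
      2 * r * (?N - r) * (?N choose r)"
    using card_nsets_mem_notmem[OF assms(1-4), of r]
      card_nsets_mem_notmem[OF assms(1,3,2) assms(4)[symmetric], of r]
    by (simp add: add_mult_distrib2 card_nsets)
  from this[THEN arg_cong[where f = real]]
  have "real ?N * (real ?N - 1) * real (card {A \<in> [U]\<^bsup>r\<^esup>. (i \<in> A) \<noteq> (j \<in> A)}) =
      2 * real r * (real ?N - real r) * real (?N choose r)"
    using \<open>1 < ?N\<close> assms(5) by (simp add: of_nat_diff)
  moreover have "?N choose r > 0" using assms(5) by simp
  ultimately show ?thesis
    using \<open>1 < ?N\<close> unfolding split_prob_def prob_random_nset[OF assms(1,5)]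
    by (simp add: frac_eq_eq mult.commute)
qed

text \<open>The midpoints \<open>Inr i\<close> with \<open>i \<ge> n\<close> are not vertices of \<open>K2 n\<close>; they make the number of
  midpoints even.\<close>

definition K2_cut_pmf :: "nat \<Rightarrow> (bool + nat) set pmf" where
  "K2_cut_pmf m = map_pmf (\<lambda>H. insert (Inl True) (Inr ` H)) (pmf_of_set ([{..<2 * m}]\<^bsup>m\<^esup>))"

lemma K2_simps [simp]:
  "verts (K2 n) = range Inl \<union> Inr ` {..<n}" "edges (K2 n) = UNIV \<times> {..<n}"
  "tail (K2 n) (b, i) = Inl b" "head (K2 n) (b, i) = Inr i" "len (K2 n) a = 1"
  "src (K2 n) = Inl False" "snk (K2 n) = Inl True"
  by (simp_all add: K2_def)

lemma mem_prob_K2_cut_pmf: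
  "mem_prob (K2_cut_pmf m) (Inl b) = of_bool b"
  "i < 2 * m \<Longrightarrow> mem_prob (K2_cut_pmf m) (Inr i) = 1 / 2"
proof -
  show "mem_prob (K2_cut_pmf m) (Inl b) = of_bool b"
    by (simp add: mem_prob_def K2_cut_pmf_def vimage_def image_iff)
  show "mem_prob (K2_cut_pmf m) (Inr i) = 1 / 2" if "i < 2 * m"
    using mem_prob_random_nset[of "{..<2 * m}" i m] that
    by (simp add: mem_prob_def K2_cut_pmf_def vimage_def image_iff)
qed

lemma split_prob_K2_cut_pmf:
  "split_prob (K2_cut_pmf m) (Inl b) (Inl b') = of_bool (b \<noteq> b')"
  "i < 2 * m \<Longrightarrow> split_prob (K2_cut_pmf m) (Inl b) (Inr i) = 1 / 2"
  "i < 2 * m \<Longrightarrow> j < 2 * m \<Longrightarrow>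
    split_prob (K2_cut_pmf m) (Inr i) (Inr j) = (if i = j then 0 else real m / (2 * real m - 1))"
proof -
  show "split_prob (K2_cut_pmf m) (Inl b) (Inl b') = of_bool (b \<noteq> b')"
    by (simp add: split_prob_def K2_cut_pmf_def vimage_def image_iff)
  show "split_prob (K2_cut_pmf m) (Inl b) (Inr i) = 1 / 2" if "i < 2 * m"
    using mem_prob_random_nset[of "{..<2 * m}" i m]
      prob_notmem[of "pmf_of_set ([{..<2 * m}]\<^bsup>m\<^esup>)" i] that
    by (cases b) (simp_all add: mem_prob_def split_prob_def K2_cut_pmf_def vimage_def image_iff)
  show "split_prob (K2_cut_pmf m) (Inr i) (Inr j) =
      (if i = j then 0 else real m / (2 * real m - 1))"
    if "i < 2 * m" "j < 2 * m"
  proof -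
    have "2 * real m * (2 * real m - real m) / (2 * real m * (2 * real m - 1)) =
        real m / (2 * real m - 1)"
      using that by (simp add: divide_simps)
    then show ?thesis
      using split_prob_random_nset[of "{..<2 * m}" i j m] that
      by (simp add: split_prob_def K2_cut_pmf_def vimage_def image_iff)
  qed
qed

locale K2_powers =
  fixes n m :: nat
  assumes n_ge_1: "1 \<le> n" and n_le: "n \<le> 2 * m"
begin

definition mid_split :: real where
  "mid_split = real m / (2 * real m - 1)"

lemma m_ge_1: "1 \<le> m"
  using n_ge_1 n_le by simp

lemma mid_split_pos: "0 < mid_split"
  using m_ge_1 by (simp add: mid_split_def)

lemma st_dist_K2: "st_dist (K2 n) = 2"
  unfolding st_dist_def by (rule sp_dist_K2[OF n_ge_1])

lemma rel_len_K2: "rel_len (K2 n) a = 1 / 2"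
  by (simp add: rel_len_def st_dist_K2)

lemma endpoints_K2:
  "tail (K2 n) ` edges (K2 n) = range Inl"
  "head (K2 n) ` edges (K2 n) = Inr ` {..<n}"
proof -
  have "Inl b \<in> tail (K2 n) ` edges (K2 n)" for b
    using n_ge_1 by (intro image_eqI[of _ _ "(b, 0)"]) simp_all
  then show "tail (K2 n) ` edges (K2 n) = range Inl" by auto
  have "Inr i \<in> head (K2 n) ` edges (K2 n)" if "i < n" for i
    using that by (intro image_eqI[of _ _ "(False, i)"]) simp_all
  then show "head (K2 n) ` edges (K2 n) = Inr ` {..<n}" by auto
qed

sublocale geodesic_st_cut "K2 n" "K2_cut_pmf m"
proof unfold_locales
  show "verts (K2 n) = tail (K2 n) ` edges (K2 n) \<union> head (K2 n) ` edges (K2 n)"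
    unfolding endpoints_K2 by simp
  show "finite (edges (K2 n))" by simp
  show "finite (set_pmf (K2_cut_pmf m))"
    unfolding K2_cut_pmf_def by (simp add: finite_imp_finite_nsets nsets_eq_empty_iff)
  show "src (K2 n) \<notin> A \<and> snk (K2 n) \<in> A" if "A \<in> set_pmf (K2_cut_pmf m)" for A
    using that by (auto simp: K2_cut_pmf_def)
  show "st_dist (K2 n) \<noteq> 0"
    by (simp add: st_dist_K2)
  have hub: "walk (K2 n) (Inl b) 0 (Inl b)" for b
    by (rule walk.nil) simp
  have spoke: "walk (K2 n) (Inl b) 1 (Inr i)" "walk (K2 n) (Inr i) 1 (Inl b)" if "i < n" for b i
    using walk_edge[of "(b, i)" "K2 n"] that by simp_all
  have across: "walk (K2 n) (Inl False) 2 (Inl True)"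
    using walk_trans[OF spoke(1)[of 0 False] spoke(2)[of 0 True]] n_ge_1 by simp
  show "walk (K2 n) (src (K2 n)) (mem_prob (K2_cut_pmf m) x * st_dist (K2 n)) x"
      "walk (K2 n) x ((1 - mem_prob (K2_cut_pmf m) x) * st_dist (K2 n)) (snk (K2 n))"
    if x: "x \<in> verts (K2 n)" for x
  proof -
    consider "x = Inl False" | "x = Inl True" | i where "x = Inr i" "i < n" "i < 2 * m"
      using x n_le by fastforce
    then have "walk (K2 n) (Inl False) (mem_prob (K2_cut_pmf m) x * 2) x \<and>
        walk (K2 n) x ((1 - mem_prob (K2_cut_pmf m) x) * 2) (Inl True)"
      by cases (simp_all add: mem_prob_K2_cut_pmf hub spoke across)
    then show "walk (K2 n) (src (K2 n)) (mem_prob (K2_cut_pmf m) x * st_dist (K2 n)) x"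
      "walk (K2 n) x ((1 - mem_prob (K2_cut_pmf m) x) * st_dist (K2 n)) (snk (K2 n))"
      by (simp_all add: st_dist_K2)
  qed
  show "rel_len (K2 n) a =
      \<bar>mem_prob (K2_cut_pmf m) (head (K2 n) a) - mem_prob (K2_cut_pmf m) (tail (K2 n) a)\<bar>"
    "split_prob (K2_cut_pmf m) (tail (K2 n) a) (head (K2 n) a) = rel_len (K2 n) a"
    if "a \<in> edges (K2 n)" for a
    using that n_le by (auto simp: rel_len_K2 mem_prob_K2_cut_pmf split_prob_K2_cut_pmf)
qed auto

lemma split_prob_different_K2_copies:
  fixes k u v
  assumes "i < n" "j < n" "(b, i) \<noteq> (b', j)"
  defines "p \<equiv> mem_prob (cut_pmf k) u" and "q \<equiv> mem_prob (cut_pmf k) v"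
  shows "split_prob (cut_pmf (Suc k)) (copy_vert (K2 n) (b, i) u) (copy_vert (K2 n) (b', j) v) =
    (if i = j then 1 - (p + q) / 2
     else if b = b' then (p + q) / 2 - (1 - mid_split) * p * q
     else 1 - (p + q) / 2 + mid_split * p * q)"
proof -
  have "i < 2 * m" "j < 2 * m" "i = j \<Longrightarrow> b \<noteq> b'" using assms n_le by auto
  have "split_prob (cut_pmf (Suc k)) (copy_vert (K2 n) (b, i) u) (copy_vert (K2 n) (b', j) v) =
      (1 - p) * (1 - q) * of_bool (b \<noteq> b') + (1 - p) * q * (1 / 2) + p * (1 - q) * (1 / 2) +
      p * q * (if i = j then 0 else mid_split)"
    using split_prob_different_copies[of "(b, i)" "(b', j)" k u v] assms(1-3)
      split_prob_K2_cut_pmf(1)[of m b b']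
      split_prob_K2_cut_pmf(2)[OF \<open>j < 2 * m\<close>, of b]
      split_prob_K2_cut_pmf(2)[OF \<open>i < 2 * m\<close>, of b', unfolded split_prob_commute[of _ "Inl b'"]]
      split_prob_K2_cut_pmf(3)[OF \<open>i < 2 * m\<close> \<open>j < 2 * m\<close>]
    by (simp only: K2_simps p_def q_def mid_split_def SigmaI UNIV_I lessThan_iff simp_thms)
  then show ?thesis
    using \<open>i = j \<Longrightarrow> b \<noteq> b'\<close> by (auto simp: algebra_simps add_divide_distrib diff_divide_distrib)
qed

lemma walk_K2_copy_to_endpoints:
  assumes "i < n" "u \<in> verts (Gpow k)"
  shows "walk (Gpow (Suc k)) (copy_vert (K2 n) (b, i) u) (mem_prob (cut_pmf k) u / 2)
      (base_vert (K2 n) k (Inl b))"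
    and "walk (Gpow (Suc k)) (copy_vert (K2 n) (b, i) u) ((1 - mem_prob (cut_pmf k) u) / 2)
      (base_vert (K2 n) k (Inr i))"
  using walk_copy_vert_from_tail_to_head[of "(b, i)" u k] assms walk_sym_Gpow
  by (auto simp: rel_len_K2)

lemma walk_different_K2_copies:
  fixes k u v
  assumes "i < n" "j < n" "(b, i) \<noteq> (b', j)" and uv: "u \<in> verts (Gpow k)" "v \<in> verts (Gpow k)"
  defines "p \<equiv> mem_prob (cut_pmf k) u" and "q \<equiv> mem_prob (cut_pmf k) v"
  shows "walk (Gpow (Suc k)) (copy_vert (K2 n) (b, i) u)
    (if i = j then 1 - (p + q) / 2 else if b = b' then (p + q) / 2 else 1 - \<bar>p - q\<bar> / 2)
    (copy_vert (K2 n) (b', j) v)"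
proof -
  let ?u = "copy_vert (K2 n) (b, i) u" and ?v = "copy_vert (K2 n) (b', j) v"
  let ?pole = "\<lambda>b. base_vert (K2 n) k (Inl b)" and ?mid = "\<lambda>i. base_vert (K2 n) k (Inr i)"
  note u_pole = walk_K2_copy_to_endpoints(1)[OF assms(1) uv(1), of b, folded p_def]
    and u_mid = walk_K2_copy_to_endpoints(2)[OF assms(1) uv(1), of b, folded p_def]
    and pole_v = walk_K2_copy_to_endpoints(1)[OF assms(2) uv(2), of b', folded q_def,
      THEN walk_sym_Gpow]
    and mid_v = walk_K2_copy_to_endpoints(2)[OF assms(2) uv(2), of b', folded q_def,
      THEN walk_sym_Gpow]
  have spoke: "walk (Gpow (Suc k)) (?pole c) (1 / 2) (?mid h)" if "h < n" for c h
    using walk_base_vert_edge[of "(c, h)" k] that by (simp add: rel_len_K2)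
  consider (same_mid) "i = j" | (same_pole) "i \<noteq> j" "b = b'"
    | (via_mid_i) "i \<noteq> j" "b \<noteq> b'" "q \<le> p" | (via_mid_j) "i \<noteq> j" "b \<noteq> b'" "p \<le> q"
    by linarith
  then show ?thesis
  proof cases
    case same_mid
    have "walk (Gpow (Suc k)) ?u ((1 - p) / 2 + (1 - q) / 2) ?v"
      using mid_v by (intro walk_trans[OF u_mid]) (simp add: same_mid)
    moreover have "(1 - p) / 2 + (1 - q) / 2 = 1 - (p + q) / 2" by (simp add: field_simps)
    ultimately show ?thesis using same_mid by simp
  next
    case same_pole
    then show ?thesis using walk_trans[OF u_pole] pole_v by (simp add: add_divide_distrib)
  next
    case via_mid_i
    have "walk (Gpow (Suc k)) ?u ((1 - p) / 2 + 1 / 2 + q / 2) ?v"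
      using assms(1) by (intro walk_trans[OF walk_trans[OF u_mid walk_sym_Gpow[OF spoke]] pole_v])
    moreover have "(1 - p) / 2 + 1 / 2 + q / 2 = 1 - \<bar>p - q\<bar> / 2"
      using via_mid_i by (simp add: field_simps)
    ultimately show ?thesis using via_mid_i by simp
  next
    case via_mid_j
    have "walk (Gpow (Suc k)) ?u (p / 2 + 1 / 2 + (1 - q) / 2) ?v"
      using assms(2) by (intro walk_trans[OF walk_trans[OF u_pole spoke] mid_v])
    moreover have "p / 2 + 1 / 2 + (1 - q) / 2 = 1 - \<bar>p - q\<bar> / 2"
      using via_mid_j by (simp add: field_simps)
    ultimately show ?thesis using via_mid_j by simp
  qed
qed

end

section \<open>Embedding random sets into \<open>L\<^sub>1\<close>\<close>

lemma has_bochner_integral_unit_leb_indicator: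
  assumes "0 \<le> a" "a \<le> b" "b \<le> 1"
  shows "has_bochner_integral unit_leb (indicator {a..<b}) (b - a)"
proof -
  have subset: "{a..<b} \<subseteq> {0..1}" using assms by auto
  then have "{a..<b} \<in> sets unit_leb" by (simp add: sets_restrict_space_iff)
  moreover have "emeasure unit_leb {a..<b} = ennreal (b - a)"
    using assms subset by (subst emeasure_restrict_space) simp_all
  ultimately show ?thesis
    using has_bochner_integral_real_indicator[of "{a..<b}" unit_leb] assms
    by (simp add: measure_def)
qed

lemma has_bochner_integral_step:
  fixes \<phi> :: "nat \<Rightarrow> real"
  assumes "0 < N"
  shows "has_bochner_integral unit_leb (\<lambda>t. \<phi> (nat \<lfloor>N * t\<rfloor>)) (\<Sum>r<N. \<phi> r / N)"
proof -
  define B :: "nat \<Rightarrow> real set" where "B r = {r / N..<(real r + 1) / N}" for r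
  have "has_bochner_integral unit_leb (indicator (B r)) (1 / N)" if "r < N" for r
    using has_bochner_integral_unit_leb_indicator[of "r / N" "(real r + 1) / N"] that
    by (simp add: B_def divide_right_mono diff_divide_distrib[symmetric])
  then have integral_sum: "has_bochner_integral unit_leb
      (\<lambda>t. \<Sum>r<N. \<phi> r * indicator (B r) t) (\<Sum>r<N. \<phi> r * (1 / N))"
    by (intro has_bochner_integral_sum has_bochner_integral_mult_right) auto
  have sum_eq: "(\<Sum>r<N. \<phi> r * indicator (B r) t) = \<phi> (nat \<lfloor>N * t\<rfloor>)"
    if "0 \<le> t" "t < 1" for t :: real
  proof -
    have "t \<in> B r \<longleftrightarrow> r = nat \<lfloor>N * t\<rfloor>" for r
    proof -
      have "t \<in> B r \<longleftrightarrow> \<lfloor>N * t\<rfloor> = int r"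
        using assms by (auto simp: B_def field_simps floor_eq_iff)
      then show ?thesis using that by auto
    qed
    moreover have "nat \<lfloor>N * t\<rfloor> < N"
      using that assms by (simp add: nat_less_iff floor_less_iff)
    ultimately show ?thesis by (simp add: indicator_def if_distrib[of "(*) _"] cong: if_cong)
  qed
  have "AE t in unit_leb. t \<noteq> 1"
    using AE_completion[OF AE_lborel_singleton[of 1]]
    by (auto simp: AE_restrict_space_iff elim: eventually_mono)
  then have "AE t in unit_leb. (\<Sum>r<N. \<phi> r * indicator (B r) t) = \<phi> (nat \<lfloor>N * t\<rfloor>)"
    using AE_space by eventually_elim (rule sum_eq; simp)
  moreover have "(\<lambda>t. \<phi> (nat \<lfloor>N * t\<rfloor>)) \<in> borel_measurable unit_leb"
    by (intro measurable_restrict_space1 measurable_completion) simp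
  ultimately show ?thesis
    using integral_sum
    by (subst has_bochner_integral_cong_AE[symmetric]) (auto simp: has_bochner_integral_iff)
qed

lemma ex_L1_split_prob:
  assumes "finite (set_pmf M)"
  shows "\<exists>F :: 'a \<Rightarrow> L1. \<forall>x y. dist (F x) (F y) = split_prob M x y"
proof -
  define N where "N = card (set_pmf M)"
  have N_pos: "0 < N" using assms by (simp add: N_def card_gt_0_iff set_pmf_not_empty)
  obtain A where bij_A: "bij_betw A {..<N} (set_pmf M)"
    using ex_bij_betw_nat_finite[OF assms] by (auto simp: N_def atLeast0LessThan)
  define \<phi> where "\<phi> x r = N * pmf M (A r) * of_bool (x \<in> A r)" for x r
  define f where "f x = (\<lambda>t::real. \<phi> x (nat \<lfloor>N * t\<rfloor>))" for x
  have L1_f: "L1_rel (f x) (f x)" for x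
    using has_bochner_integral_step[OF N_pos, of "\<phi> x"]
    by (simp add: L1_rel_def f_def has_bochner_integral_iff)
  have "dist (abs_L1 (f x)) (abs_L1 (f y)) = split_prob M x y" for x y
  proof -
    have "dist (abs_L1 (f x)) (abs_L1 (f y)) = (\<integral>t. \<bar>f x t - f y t\<bar> \<partial>unit_leb)"
      by (rule dist_L1.abs_eq) (rule L1_f)+
    also have "\<dots> = (\<Sum>r<N. \<bar>\<phi> x r - \<phi> y r\<bar> / N)"
      unfolding f_def
      by (rule has_bochner_integral_integral_eq[OF has_bochner_integral_step[OF N_pos]])
    also have "\<dots> = (\<Sum>r<N. pmf M (A r) * of_bool ((x \<in> A r) \<noteq> (y \<in> A r)))"
      using N_pos by (intro sum.cong) (auto simp: \<phi>_def)
    also have "\<dots> = (\<Sum>S\<in>set_pmf M. pmf M S * of_bool ((x \<in> S) \<noteq> (y \<in> S)))"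
      by (rule sum.reindex_bij_betw[OF bij_A])
    also have "\<dots> = (\<Sum>S\<in>{S. (x \<in> S) \<noteq> (y \<in> S)} \<inter> set_pmf M. pmf M S)"
      using assms by (intro sum.mono_neutral_cong_right) auto
    also have "\<dots> = split_prob M x y"
      using assms
      by (simp add: split_prob_def measure_measure_pmf_finite[symmetric] measure_Int_set_pmf)
    finally show ?thesis .
  qed
  then show ?thesis by (intro exI[of _ "\<lambda>x. abs_L1 (f x)"]) blast
qed

lemma c1_le:
  fixes f :: "'a \<Rightarrow> L1"
  assumes pos: "\<And>x y. x \<in> X \<Longrightarrow> y \<in> X \<Longrightarrow> x \<noteq> y \<Longrightarrow> 0 < d x y"
    and upper: "\<And>x y. x \<in> X \<Longrightarrow> y \<in> X \<Longrightarrow> dist (f x) (f y) \<le> d x y"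
    and lower: "\<And>x y. x \<in> X \<Longrightarrow> y \<in> X \<Longrightarrow> d x y \<le> D * dist (f x) (f y)"
  shows "c1 X d \<le> ennreal D"
proof -
  have inj: "inj_on f X"
  proof (rule inj_onI, rule ccontr)
    fix x y assume "x \<in> X" "y \<in> X" "f x = f y" "x \<noteq> y"
    then show False using pos[of x y] lower[of x y] by simp
  qed
  have "lip_const X d dist f \<le> 1"
    unfolding lip_const_def
  proof (rule SUP_least, clarify)
    fix x y assume "x \<in> X" "y \<in> X" "x \<noteq> y"
    then have "dist (f x) (f y) / d x y \<le> 1" using pos upper by simp
    then show "ennreal (dist (f x) (f y) / d x y) \<le> 1" by (simp add: ennreal_le_1)
  qed
  moreover have "lip_const (f ` X) dist d (inv_into X f) \<le> ennreal D"
    unfolding lip_const_def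
  proof (rule SUP_least, clarify)
    fix x y assume "x \<in> X" "y \<in> X" "f x \<noteq> f y"
    then have "d x y / dist (f x) (f y) \<le> D" using lower by (simp add: divide_le_eq)
    then show "ennreal (d (inv_into X f (f x)) (inv_into X f (f y)) / dist (f x) (f y)) \<le> ennreal D"
      using inj \<open>x \<in> X\<close> \<open>y \<in> X\<close> by (simp add: ennreal_leI)
  qed
  ultimately have "lip_const X d dist f * lip_const (f ` X) dist d (inv_into X f) \<le> 1 * ennreal D"
    by (rule mult_mono) auto
  then have "distortion X d dist f \<le> ennreal D" using inj by (simp add: distortion_def)
  then show ?thesis unfolding c1_def by (rule Inf_lower2[OF rangeI[of _ f]])
qed

section \<open>The distortion bound\<close>

lemma same_terminal_ratio:
  fixes p q \<sigma> :: real
  assumes "0 < \<sigma>" "0 \<le> p" "p \<le> 1" "0 \<le> q" "q \<le> 1"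
  shows "(1 - 1 / (4 * \<sigma>)) * ((p + q) / 2) \<le> (p + q) / 2 - (1 - \<sigma>) * p * q"
proof -
  have "p * q \<le> p" "p * q \<le> q"
    using assms by (simp_all add: mult_left_le mult_left_le_one_le)
  then have pq: "2 * (p * q) \<le> p + q" by simp
  have "4 * \<sigma> * (1 - \<sigma>) = 1 - (2 * \<sigma> - 1)\<^sup>2"
    by (simp add: power2_eq_square algebra_simps)
  then have "4 * \<sigma> * (1 - \<sigma>) * (2 * (p * q)) \<le> 1 * (2 * (p * q))"
    using assms by (intro mult_right_mono) auto
  with pq have "8 * \<sigma> * ((1 - \<sigma>) * p * q) \<le> p + q" by (simp add: algebra_simps)
  then have "(1 - \<sigma>) * p * q \<le> (p + q) / (8 * \<sigma>)"
    using assms(1) by (simp add: pos_le_divide_eq mult.commute)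
  then show ?thesis using assms(1) by (simp add: field_simps)
qed

lemma opposite_terminal_ratio:
  fixes p q \<sigma> :: real
  assumes "0 < \<sigma>" "0 \<le> p" "p \<le> 1" "0 \<le> q" "q \<le> 1"
  shows "(1 - 1 / (4 * \<sigma>)) * (1 - \<bar>p - q\<bar> / 2) \<le> 1 - (p + q) / 2 + \<sigma> * p * q"
  using assms(2-)
proof (induction q p rule: linorder_wlog)
  case (sym q p)
  then show ?case by (simp add: abs_minus_commute add.commute mult.commute mult.left_commute)
next
  case (le q p)
  show ?case
  proof (cases "p = 0")
    case True
    then show ?thesis using assms(1) le by simp
  next
    case False
    define D where "D = 1 - (p + q) / 2 + \<sigma> * p * q - (1 - 1 / (4 * \<sigma>)) * (1 - (p - q) / 2)"
    \<comment> \<open>\<open>D\<close> is affine in \<open>q\<close>: interpolate between \<open>q = 0\<close> and \<open>q = p\<close>.\<close>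
    have "\<sigma> * (1 / (4 * \<sigma>)) = 1 / 4" using assms(1) by simp
    then have "8 * \<sigma> * p * D = (p - q) * (2 - p) + q * (1 - 2 * \<sigma> * p)\<^sup>2 * 2"
      unfolding D_def by algebra
    also have "\<dots> \<ge> 0" using le by (intro add_nonneg_nonneg mult_nonneg_nonneg) auto
    finally have "0 \<le> 8 * \<sigma> * p * D" .
    moreover have "0 < 8 * \<sigma> * p" using assms(1) le False by simp
    ultimately have "0 \<le> D" by (meson mult_pos_neg not_le)
    then show ?thesis using le by (simp add: D_def)
  qed
qed

context K2_powers
begin

lemma walk_le_split_prob_different_copies:
  assumes "i < n" "j < n" "(b, i) \<noteq> (b', j)" and "u \<in> verts (Gpow k)" "v \<in> verts (Gpow k)"
  obtains l where "walk (Gpow (Suc k)) (copy_vert (K2 n) (b, i) u) l (copy_vert (K2 n) (b', j) v)"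
    and "(1 - 1 / (4 * mid_split)) * l
      \<le> split_prob (cut_pmf (Suc k)) (copy_vert (K2 n) (b, i) u) (copy_vert (K2 n) (b', j) v)"
proof -
  define p q where "p = mem_prob (cut_pmf k) u" and "q = mem_prob (cut_pmf k) v"
  have pq: "0 \<le> p" "p \<le> 1" "0 \<le> q" "q \<le> 1"
    by (simp_all add: p_def q_def mem_prob_bounds)
  define l where
    "l = (if i = j then 1 - (p + q) / 2 else if b = b' then (p + q) / 2 else 1 - \<bar>p - q\<bar> / 2)"
  have "(1 - 1 / (4 * mid_split)) * (1 - (p + q) / 2) \<le> 1 * (1 - (p + q) / 2)"
    using pq mid_split_pos by (intro mult_right_mono) simp_all
  then have "(1 - 1 / (4 * mid_split)) * l
      \<le> split_prob (cut_pmf (Suc k)) (copy_vert (K2 n) (b, i) u) (copy_vert (K2 n) (b', j) v)"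
    unfolding l_def split_prob_different_K2_copies[OF assms(1-3)] p_def[symmetric] q_def[symmetric]
    using same_terminal_ratio[OF mid_split_pos pq] opposite_terminal_ratio[OF mid_split_pos pq]
    by simp
  with walk_different_K2_copies[OF assms, folded p_def q_def, folded l_def]
  show ?thesis by (rule that)
qed

lemma walk_le_split_prob:
  assumes "u \<in> verts (Gpow k)" "v \<in> verts (Gpow k)"
  shows "\<exists>l. walk (Gpow k) u l v \<and> (1 - 1 / (4 * mid_split)) * l \<le> split_prob (cut_pmf k) u v"
  using assms
proof (induction k arbitrary: u v)
  case 0
  show ?case
  proof (cases "u = v")
    case True
    then show ?thesis
      using 0 walk.nil[of u "Gpow 0"] by (intro exI[of _ 0]) (simp add: split_prob_def)
  next
    case False
    have "walk (Gpow 0) u 1 v"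
      using 0 False walk_oslash_pow_0 by auto
    moreover have "split_prob (cut_pmf 0) u v = 1"
      using 0 False split_prob_cut_pmf_0 split_prob_commute[of "cut_pmf 0"] by auto
    ultimately show ?thesis using mid_split_pos by (intro exI[of _ 1]) simp
  qed
next
  case (Suc k)
  then obtain b i u' b' j v'
    where u: "i < n" "u' \<in> verts (Gpow k)" "u = copy_vert (K2 n) (b, i) u'"
      and v: "j < n" "v' \<in> verts (Gpow k)" "v = copy_vert (K2 n) (b', j) v'"
    by (auto simp: verts_Gpow_Suc_eq_copies)
  show ?case
  proof (cases "(b, i) = (b', j)")
    case True
    from Suc.IH[OF u(2) v(2)] obtain l where walk_l: "walk (Gpow k) u' l v'"
      and l_le: "(1 - 1 / (4 * mid_split)) * l \<le> split_prob (cut_pmf k) u' v'" by blast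
    have "walk (Gpow (Suc k)) u (l / 2) v"
      using walk_copy_vert[OF _ walk_l, of "(b, i)"] True by (simp add: u v rel_len_K2)
    moreover have "split_prob (cut_pmf (Suc k)) u v = split_prob (cut_pmf k) u' v' / 2"
      using split_prob_same_copy[of "(b, i)" k u' v'] u(1) True n_le
      by (simp add: u(3) v(3) split_prob_K2_cut_pmf)
    ultimately show ?thesis using l_le by (intro exI[of _ "l / 2"]) simp
  next
    case False
    from walk_le_split_prob_different_copies[OF u(1) v(1) this u(2) v(2)] show ?thesis
      unfolding u(3) v(3) by blast
  qed
qed

lemma walk_Gpow_exists:
  assumes "u \<in> verts (Gpow k)" "v \<in> verts (Gpow k)"
  obtains l where "walk (Gpow k) u l v"
  using walk_le_split_prob[OF assms] by blast

lemma sp_dist_Gpow_pos: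
  assumes "u \<in> verts (Gpow k)" "v \<in> verts (Gpow k)" "u \<noteq> v"
  shows "0 < sp_dist (Gpow k) u v"
proof -
  obtain l where "walk (Gpow k) u l v" using walk_Gpow_exists[OF assms(1,2)] .
  then have "1 / 2 ^ k \<le> sp_dist (Gpow k) u v"
    using assms(3) by (rule edge_length_bound_le_sp_dist) (simp_all add: len_K2_pow[OF n_ge_1])
  then show ?thesis by (rule less_le_trans[rotated]) simp
qed

lemma sp_dist_le_split_prob:
  assumes "u \<in> verts (Gpow k)" "v \<in> verts (Gpow k)"
  shows "sp_dist (Gpow k) u v \<le> (2 - 2 / (2 * real m + 1)) * split_prob (cut_pmf k) u v"
proof -
  have ratio: "1 - 1 / (4 * mid_split) = (2 * real m + 1) / (4 * real m)"
    and distortion: "2 - 2 / (2 * real m + 1) = 4 * real m / (2 * real m + 1)"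
    using m_ge_1 by (simp_all add: mid_split_def field_simps)
  obtain l where walk_l: "walk (Gpow k) u l v"
    and l_le: "(1 - 1 / (4 * mid_split)) * l \<le> split_prob (cut_pmf k) u v"
    using walk_le_split_prob[OF assms] by blast
  have "sp_dist (Gpow k) u v \<le> l"
    using walk_l by (rule sp_dist_le_walk) (simp add: len_K2_pow[OF n_ge_1])
  also have "l = (2 - 2 / (2 * real m + 1)) * ((1 - 1 / (4 * mid_split)) * l)"
    unfolding ratio distortion using m_ge_1 by simp
  also have "\<dots> \<le> (2 - 2 / (2 * real m + 1)) * split_prob (cut_pmf k) u v"
    using l_le m_ge_1 by (intro mult_left_mono) (simp_all add: field_simps)
  finally show ?thesis .
qed

lemma c1_Gpow_le: "c1 (verts (Gpow k)) (sp_dist (Gpow k)) \<le> ennreal (2 - 2 / (2 * real m + 1))"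
proof -
  obtain F :: "_ \<Rightarrow> L1" where dist_F: "dist (F u) (F v) = split_prob (cut_pmf k) u v" for u v
    using ex_L1_split_prob[OF finite_set_cut_pmf] by blast
  show ?thesis
  proof (rule c1_le[where f = F])
    fix u v assume uv: "u \<in> verts (Gpow k)" "v \<in> verts (Gpow k)"
    show "u \<noteq> v \<Longrightarrow> 0 < sp_dist (Gpow k) u v" by (rule sp_dist_Gpow_pos[OF uv])
    show "dist (F u) (F v) \<le> sp_dist (Gpow k) u v"
      unfolding dist_F using walk_Gpow_exists[OF uv] split_prob_le_sp_dist by metis
    show "sp_dist (Gpow k) u v \<le> (2 - 2 / (2 * real m + 1)) * dist (F u) (F v)"
      unfolding dist_F by (rule sp_dist_le_split_prob[OF uv])
  qed
qed

end

theorem theorem5p1: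
  fixes n k :: nat
  assumes "n \<ge> 1" and "k \<ge> 1"
  shows "c1 (verts (oslash_pow (K2 n) k)) (sp_dist (oslash_pow (K2 n) k))
           \<le> ennreal (2 - 2 / (2 * real_of_int \<lceil>real n / 2\<rceil> + 1))"
proof -
  define m where "m = nat \<lceil>real n / 2\<rceil>"
  have ceiling_eq: "real_of_int \<lceil>real n / 2\<rceil> = real m" by (simp add: m_def)
  have "real n \<le> 2 * real m"
    unfolding ceiling_eq[symmetric] using le_of_int_ceiling[of "real n / 2"] by linarith
  then interpret K2_powers n m
    using assms(1) by unfold_locales linarith+
  show ?thesis unfolding ceiling_eq by (rule c1_Gpow_le)
qed

end
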